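(* Let $G$ be a nontrivial finite nilpotent group. Then (i) $\mathrm{DNG}(G)=*1$ if $|G|=2$ or $|G|$ is odd; (ii) $\mathrm{DNG}(G)=*3$ if $G\cong\mathbb{Z}_2\times\mathbb{Z}_{2k+1}$ for some integer $k\ge 1$; (iii) $\mathrm{DNG}(G)=*0$ otherwise.
   Context: For a nontrivial finite group $G$, the avoidance game $\mathrm{DNG}(G)$ is the impartial game whose positions are the subsets $P\subseteq G$ with $\langle P\rangle\ne G$; the starting position is $\emptyset$; the options of $P$ are the positions of the form $P\cup\{g\}$ with $g\in G\setminus P$ (and $\langle P\cup\{g\}\rangle\neq G$). Two players alternate moves, and a player who cannot move loses (normal play). The nim-number of a position $P$ is defined recursively by $\mathrm{nim}(P)=\mathrm{mex}\{\mathrm{nim}(Q)\mid Q \text{ an option of } P\}$, where $\mathrm{mex}(A)$ is the least non-negative integer not in $A$. The notation $\mathrm{DNG}(G)=*n$ means that the starting position $\emptyset$ has nim-number $n$. $\mathbb{Z}_m$ is the cyclic group of order $m$. *)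

theory Defs
  imports "HOL-Algebra.Elementary_Groups" "HOL-Algebra.Generated_Groups"
begin

section \<open>Nilpotent groups\<close>

text \<open>The lower central series, indexed so that stage \<open>0\<close> is the whole group. The commutator
  convention \<open>x y x\<inverse> y\<inverse>\<close> is that of \<^const>\<open>derived\<close>.\<close>

fun lower_central :: "('a, 'b) monoid_scheme \<Rightarrow> nat \<Rightarrow> 'a set" where
  "lower_central G 0 = carrier G"
| "lower_central G (Suc n) =
     generate G (\<Union>x \<in> lower_central G n. \<Union>y \<in> carrier G.
       {x \<otimes>\<^bsub>G\<^esub> y \<otimes>\<^bsub>G\<^esub> inv\<^bsub>G\<^esub> x \<otimes>\<^bsub>G\<^esub> inv\<^bsub>G\<^esub> y})"

definition nilpotent :: "('a, 'b) monoid_scheme \<Rightarrow> bool" where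
  "nilpotent G \<longleftrightarrow> (\<exists>n. lower_central G n = {\<one>\<^bsub>G\<^esub>})"

section \<open>Nim-numbers\<close>

definition mex :: "nat set \<Rightarrow> nat" where
  "mex A = (LEAST n. n \<notin> A)"

text \<open>A game is given by its option relation \<open>R\<close>, where \<open>(q, p) \<in> R\<close> means that \<open>q\<close> is an option
  of \<open>p\<close>. The recursion is meaningful when \<open>R\<close> is well-founded; see \<open>nim_number_eq\<close>.\<close>

definition nim_number :: "('p \<times> 'p) set \<Rightarrow> 'p \<Rightarrow> nat" where
  "nim_number R = wfrec R (\<lambda>f p. mex {f q |q. (q, p) \<in> R})"

lemma nim_number_eq:
  assumes "wf R"
  shows "nim_number R p = mex {nim_number R q |q. (q, p) \<in> R}"
proof -
  have "nim_number R p = mex {cut (nim_number R) R p q |q. (q, p) \<in> R}"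
    unfolding nim_number_def by (subst wfrec[OF assms]) (rule refl)
  also have "{cut (nim_number R) R p q |q. (q, p) \<in> R} = {nim_number R q |q. (q, p) \<in> R}"
    by (auto simp: cut_def)
  finally show ?thesis .
qed

section \<open>The avoidance game\<close>

definition dng_positions :: "('a, 'b) monoid_scheme \<Rightarrow> 'a set set" where
  "dng_positions G = {P. P \<subseteq> carrier G \<and> generate G P \<noteq> carrier G}"

definition dng_option_rel :: "('a, 'b) monoid_scheme \<Rightarrow> ('a set \<times> 'a set) set" where
  "dng_option_rel G = {(P \<union> {g}, P) |P g.
     P \<in> dng_positions G \<and> g \<in> carrier G - P \<and> P \<union> {g} \<in> dng_positions G}"

lemma wf_dng_option_rel:
  assumes "finite (carrier G)"
  shows "wf (dng_option_rel G)"
proof (rule wf_subset)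
  show "dng_option_rel G \<subseteq> measure (\<lambda>P. card (carrier G - P))"
  proof clarify
    fix Q P assume "(Q, P) \<in> dng_option_rel G"
    then have "carrier G - Q \<subset> carrier G - P"
      by (auto simp: dng_option_rel_def)
    then show "(Q, P) \<in> measure (\<lambda>P. card (carrier G - P))"
      using assms by (simp add: psubset_card_mono)
  qed
qed simp

text \<open>\<open>DNG G = n\<close> renders \<open>DNG(G) = *n\<close>: the nim-number of the empty starting position.\<close>

definition DNG :: "('a, 'b) monoid_scheme \<Rightarrow> nat" where
  "DNG G = nim_number (dng_option_rel G) {}"

end

theory Submission
  imports Defs "HOL-Algebra.Multiplicative_Group" "HOL-Algebra.Sylow"
begin

text \<open>Play from a position \<open>P\<close> ends exactly when the chosen elements fill a maximal subgroup
  containing \<open>P\<close>, so the number of moves still to come has the parity of the order of that subgroup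
  minus \<open>card P\<close>. If all proper subgroups above \<open>P\<close> have orders of the same parity, the players have
  no influence on the outcome and the nim-number is 0 or 1 (\<open>dng_nim_if_parity_forced\<close>). When \<open>G\<close> has odd
  order, or order 2, every proper subgroup has odd order and the game has value 1.

  Let \<open>G\<close> have even order. Nilpotency provides a central involution \<open>t\<close>
  (\<open>nilpotent_even_obtains_central_involution\<close>). Once \<open>t\<close> is generated, all subgroups still reachable
  have even order, so a player who answers a first move \<open>g\<close> of odd order by \<open>t\<close> reaches a position
  of value 0, provided that \<open>g\<close> and \<open>t\<close> do not generate \<open>G\<close>; a first move of even order has value 1
  anyway. Hence the starting position has value 0. The proviso fails only if the cyclic group
  \<open>\<langle>g\<rangle>\<close> has odd order and index 2, and then \<open>G\<close> is the direct product of \<open>\<langle>t\<rangle>\<close> and \<open>\<langle>g\<rangle>\<close>.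

  In that exceptional case the only maximal subgroup of odd order is the cyclic
  group \<open>M\<close> of index 2. A position generating a proper subgroup of \<open>M\<close> leaves open which parity wins: adding \<open>t\<close>
  makes it even, adding a generator of \<open>M\<close> makes it odd. These two moves have the values 0 and 1 in
  some order, which lifts the undecided positions to the values 2 and 3
  (\<open>dng_nim_if_generate_odd_nonmaximal\<close>). The empty position is one of them unless \<open>M\<close> is trivial.\<close>

section \<open>Subgroups and involutions\<close>

lemma (in group) card_subgroup_dvd_card_subgroup:
  assumes "subgroup H G" "subgroup K G" "H \<subseteq> K"
  shows "card H dvd card K"
proof -
  interpret K: group "G\<lparr>carrier := K\<rparr>"
    using assms(2) by (rule subgroup_imp_group)
  have "subgroup H (G\<lparr>carrier := K\<rparr>)"
    using assms by (intro subgroup_incl)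
  then have "card (rcosets\<^bsub>G\<lparr>carrier := K\<rparr>\<^esub> H) * card H = card K"
    using K.lagrange by (simp add: order_def)
  then show ?thesis
    by (metis dvd_triv_right)
qed

lemma (in group) card_subgroup_dvd_order:
  assumes "subgroup H G"
  shows "card H dvd order G"
  using card_subgroup_dvd_card_subgroup[OF assms subgroup_self] subgroup.subset[OF assms]
  by (simp add: order_def)

lemma (in group) even_card_if_involution_mem:
  assumes "subgroup K G" "t \<in> K" "t \<noteq> \<one>" "t \<otimes> t = \<one>"
  shows "even (card K)"
proof -
  have t: "t \<in> carrier G"
    using assms(1,2) subgroup.subset by blast
  have "t [^] (2::nat) = \<one>"
    using t assms(4) by (simp add: numeral_2_eq_2)
  then have "ord t dvd 2"
    using t pow_eq_id by blast
  moreover have "ord t \<noteq> 1"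
    using t assms(3) ord_eq_1 by blast
  ultimately have "ord t = 2"
    using prime_nat_iff two_is_prime_nat by blast
  moreover have "card (generate G {t}) dvd card K"
    using assms(1,2) t
    by (intro card_subgroup_dvd_card_subgroup generate_is_subgroup generate_subgroup_incl) auto
  ultimately show ?thesis
    using generate_pow_card[OF t] by simp
qed

text \<open>If \<open>x \<otimes> x\<close> were outside \<open>M\<close>, the cosets of \<open>\<one>\<close>, \<open>x\<close> and \<open>x \<otimes> x\<close> would be three distinct ones.
  So \<open>M\<close> contains all squares, and an element of odd order is a power of its own square.\<close>

lemma (in group) odd_subgroup_le_index2_subgroup:
  assumes M: "subgroup M G" and index: "order G = 2 * card M" and fin: "finite (carrier G)"
    and H: "subgroup H G" and odd: "odd (card H)"
  shows "H \<subseteq> M"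
proof
  fix x assume x: "x \<in> H"
  then have xG: "x \<in> carrier G"
    using H subgroup.subset by blast
  have "card M > 0"
    using M fin by (metis card_gt_0_iff empty_iff finite_subset subgroup.one_closed subgroup.subset)
  then have card2: "card (rcosets M) = 2"
    using lagrange[OF M] index by simp
  have sq: "x \<otimes> x \<in> M"
  proof (rule ccontr)
    assume n2: "x \<otimes> x \<notin> M"
    then have n1: "x \<notin> M"
      using subgroup.m_closed[OF M] by blast
    have sub: "M \<subseteq> carrier G"
      using M subgroup.subset by blast
    have d1: "M #> x \<noteq> M"
      using n1 coset_join1[OF _ xG M] by blast
    have d2: "M #> (x \<otimes> x) \<noteq> M"
      using n2 coset_join1[of M "x \<otimes> x"] xG M by blast
    have d3: "M #> (x \<otimes> x) \<noteq> M #> x"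
    proof
      assume "M #> (x \<otimes> x) = M #> x"
      then have "M #> ((x \<otimes> x) \<otimes> inv x) = M"
        using coset_mult_inv2 xG sub by auto
      moreover have "(x \<otimes> x) \<otimes> inv x = x"
        using xG by (simp add: m_assoc)
      ultimately show False
        using d1 by simp
    qed
    have "M \<in> rcosets M" "M #> x \<in> rcosets M" "M #> (x \<otimes> x) \<in> rcosets M"
      using rcosetsI[OF sub one_closed] rcosetsI[OF sub xG] rcosetsI[OF sub m_closed[OF xG xG]]
      by (simp_all only: coset_mult_one[OF sub])
    then have "{M, M #> x, M #> (x \<otimes> x)} \<subseteq> rcosets M"
      by blast
    moreover have "finite (rcosets M)"
      using card2 by (intro card_ge_0_finite) simp
    ultimately have "card {M, M #> x, M #> (x \<otimes> x)} \<le> 2"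
      using card2 card_mono by metis
    then show False
      using d1 d2 d3 by simp
  qed
  from odd obtain k where k: "card H = 2 * k + 1"
    by (auto elim: oddE)
  have "ord x dvd card H"
    using card_subgroup_dvd_card_subgroup[OF generate_is_subgroup H, of "{x}"]
      generate_subgroup_incl[OF _ H, of "{x}"] generate_pow_card[OF xG] x xG by simp
  then have "x [^] (2 * k + 1) = \<one>"
    using k xG pow_eq_id by metis
  then have "x [^] Suc (2 * k + 1) = x"
    using xG by (simp only: nat_pow_Suc l_one)
  moreover have "Suc (2 * k + 1) = 2 * Suc k"
    by simp
  moreover have "x \<otimes> x = x [^] (2::nat)"
    using xG by (simp add: numeral_2_eq_2)
  ultimately have "(x \<otimes> x) [^] Suc k = x"
    using nat_pow_pow[OF xG, of 2 "Suc k"] by (simp only:)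
  moreover have "(x \<otimes> x) [^] Suc k \<in> M"
    using sq M subgroup_int_pow_closed[OF M sq, of "int (Suc k)"] by (simp only: int_pow_int)
  ultimately show "x \<in> M"
    by simp
qed

definition central_involution :: "('a, 'b) monoid_scheme \<Rightarrow> 'a \<Rightarrow> bool" where
  "central_involution G t \<longleftrightarrow> t \<in> carrier G \<and> t \<noteq> \<one>\<^bsub>G\<^esub> \<and> t \<otimes>\<^bsub>G\<^esub> t = \<one>\<^bsub>G\<^esub>
     \<and> (\<forall>x \<in> carrier G. t \<otimes>\<^bsub>G\<^esub> x = x \<otimes>\<^bsub>G\<^esub> t)"

text \<open>The elements \<open>h\<close> and \<open>t \<otimes> h\<close> with \<open>h \<in> \<langle>P\<rangle>\<close> form a subgroup because \<open>t\<close> is central, so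
  adjoining \<open>t\<close> at most doubles the order. Since \<open>t\<close> forces the order of \<open>G\<close> to be even, the index of
  the odd subgroup \<open>\<langle>P\<rangle>\<close> is even as well as at most 2.\<close>

lemma (in group) index2_if_generate_insert_central_involution:
  assumes t: "central_involution G t" and fin: "finite (carrier G)" and P: "P \<subseteq> carrier G"
    and odd: "odd (card (generate G P))" and gen: "generate G (insert t P) = carrier G"
  shows "order G = 2 * card (generate G P)"
proof -
  define H where "H = generate G P"
  define K where "K = H \<union> (\<lambda>h. t \<otimes> h) ` H"
  have tG: "t \<in> carrier G" "t \<noteq> \<one>" "t \<otimes> t = \<one>" and comm: "\<And>x. x \<in> carrier G \<Longrightarrow> t \<otimes> x = x \<otimes> t"
    using t by (auto simp: central_involution_def)
  have H: "subgroup H G"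
    unfolding H_def using P by (rule generate_is_subgroup)
  then have HG: "H \<subseteq> carrier G"
    by (rule subgroup.subset)
  have finH: "finite H"
    using HG fin finite_subset by blast
  have swap: "a \<otimes> (t \<otimes> b) = t \<otimes> (a \<otimes> b)" if "a \<in> H" "b \<in> H" for a b
  proof -
    have "a \<in> carrier G" "b \<in> carrier G"
      using that HG by auto
    then show ?thesis
      using tG comm[of a] by (metis m_assoc)
  qed
  have cancel: "t \<otimes> (t \<otimes> b) = b" if "b \<in> H" for b
    using that HG tG by (metis l_one m_assoc subsetD)
  have K: "subgroup K G"
  proof (rule subgroupI)
    show "K \<subseteq> carrier G"
      using HG tG by (auto simp: K_def)
    show "K \<noteq> {}"
      using H subgroup.one_closed by (auto simp: K_def)
    fix a assume a: "a \<in> K"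
    have "inv t = t"
      using tG inv_equality by blast
    have inv: "inv (t \<otimes> h) = t \<otimes> inv h" if "h \<in> H" for h
    proof -
      have "h \<in> carrier G"
        using that HG by blast
      then show ?thesis
        using tG comm[of "inv h"] \<open>inv t = t\<close> by (simp add: inv_mult_group)
    qed
    show "inv a \<in> K"
      using a inv subgroup.m_inv_closed[OF H] by (auto simp: K_def)
    fix b assume b: "b \<in> K"
    have mult: "t \<otimes> a \<otimes> b = t \<otimes> (a \<otimes> b)" "t \<otimes> a \<otimes> (t \<otimes> b) = a \<otimes> b" "a \<otimes> b \<in> H"
      if "a \<in> H" "b \<in> H" for a b
    proof -
      have G: "a \<in> carrier G" "b \<in> carrier G"
        using that HG by auto
      then show "t \<otimes> a \<otimes> b = t \<otimes> (a \<otimes> b)"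
        using tG m_assoc by blast
      show ab: "a \<otimes> b \<in> H"
        using that subgroup.m_closed[OF H] by blast
      show "t \<otimes> a \<otimes> (t \<otimes> b) = a \<otimes> b"
        using swap[OF that] cancel[OF ab] G tG by (simp add: m_assoc)
    qed
    show "a \<otimes> b \<in> K"
      using a b mult swap by (auto simp: K_def)
  qed
  have "t \<in> K"
    using tG subgroup.one_closed[OF H] by (auto simp: K_def image_iff intro!: bexI[of _ \<one>])
  moreover have "P \<subseteq> K"
    by (auto simp: K_def H_def intro: generate.incl)
  ultimately have "carrier G \<subseteq> K"
    using generate_subgroup_incl[of "insert t P" K] K gen by simp
  then have "order G \<le> card K"
    using finH by (simp add: order_def K_def card_mono)
  also have "\<dots> \<le> card H + card ((\<lambda>h. t \<otimes> h) ` H)"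
    unfolding K_def by (rule card_Un_le)
  also have "\<dots> \<le> 2 * card H"
    using card_image_le[OF finH, of "\<lambda>h. t \<otimes> h"] by simp
  finally have le: "order G \<le> 2 * card H" .
  have "even (order G)"
    using even_card_if_involution_mem[OF subgroup_self] tG by (simp add: order_def)
  obtain q where q: "order G = card H * q"
    using card_subgroup_dvd_order[OF H] by (auto elim: dvdE)
  have "order G > 0"
    using fin order_gt_0_iff_finite by blast
  then have "q \<le> 2" "q > 0"
    using le q by auto
  moreover have "even q"
    using \<open>even (order G)\<close> q odd by (simp add: H_def)
  ultimately have "q = 2"
    by presburger
  then show ?thesis
    using q by (simp add: H_def)
qed

section \<open>Central involutions of nilpotent groups\<close>

lemma (in group) lower_central_subgroup: "subgroup (lower_central G n) G"
proof (induction n)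
  case 0
  then show ?case
    by (simp add: subgroup_self)
next
  case (Suc n)
  then have "lower_central G n \<subseteq> carrier G"
    by (rule subgroup.subset)
  then show ?case
    by (auto intro!: generate_is_subgroup)
qed

lemma (in group) commutator_in_lower_central_Suc:
  assumes "x \<in> lower_central G n" "y \<in> carrier G"
  shows "x \<otimes> y \<otimes> inv x \<otimes> inv y \<in> lower_central G (Suc n)"
  using assms by (auto intro!: generate.incl)

text \<open>An involution \<open>x\<close> that inverts \<open>d\<close> satisfies \<open>[d, x] = d \<otimes> d\<close>, so squaring \<open>d\<close> moves one
  step down the lower central series, and \<open>x\<close> inverts the square as well.\<close>

lemma (in group) inverted_power_in_lower_central:
  assumes x: "x \<in> carrier G" "x \<otimes> x = \<one>"
    and c: "c \<in> carrier G" "x \<otimes> c \<otimes> x = inv c"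
  shows "c [^] ((2::nat) ^ k) \<in> lower_central G k
    \<and> x \<otimes> c [^] ((2::nat) ^ k) \<otimes> x = inv (c [^] ((2::nat) ^ k))"
proof (induction k)
  case 0
  then show ?case
    using c by simp
next
  case (Suc k)
  define d where "d = c [^] ((2::nat) ^ k)"
  have d: "d \<in> lower_central G k" "d \<in> carrier G" "x \<otimes> d \<otimes> x = inv d"
    using Suc c by (auto simp: d_def)
  have dd: "c [^] ((2::nat) ^ Suc k) = d \<otimes> d"
    using c by (simp add: d_def nat_pow_mult mult_2)
  have xinv: "inv x = x"
    using x inv_equality by blast
  have "x \<otimes> inv d \<otimes> x = inv (x \<otimes> d \<otimes> x)"
    using x(1) d(2) by (simp add: inv_mult_group xinv m_assoc)
  then have "x \<otimes> inv d \<otimes> x = d"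
    using d by simp
  then have "d \<otimes> x \<otimes> inv d \<otimes> inv x = d \<otimes> d"
    using x d xinv by (simp add: m_assoc)
  then have "d \<otimes> d \<in> lower_central G (Suc k)"
    using commutator_in_lower_central_Suc[OF d(1) x(1)] by simp
  moreover have "x \<otimes> (d \<otimes> d) \<otimes> x = inv (d \<otimes> d)"
  proof -
    have "x \<otimes> (d \<otimes> d) \<otimes> x = x \<otimes> d \<otimes> (x \<otimes> x) \<otimes> d \<otimes> x"
      unfolding x(2) using x(1) d(2) by (simp add: m_assoc)
    also have "\<dots> = (x \<otimes> d \<otimes> x) \<otimes> (x \<otimes> d \<otimes> x)"
      using x(1) d(2) by (simp add: m_assoc)
    also have "\<dots> = inv (d \<otimes> d)"
      using d by (simp add: inv_mult_group)
    finally show ?thesis .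
  qed
  ultimately show ?case
    using dd by simp
qed

lemma obtain_last_before_failure:
  fixes \<Phi> :: "nat \<Rightarrow> bool"
  assumes "\<Phi> 0" "\<not> \<Phi> N"
  obtains n where "\<Phi> n" "\<not> \<Phi> (Suc n)"
  using assms by (induction N) auto

text \<open>An involution \<open>x\<close> inverts every commutator \<open>[x, y]\<close>, so the iterated squares of \<open>[x, y]\<close>
  descend the lower central series and reach the identity; a nontrivial such commutator would have an involution among
  its powers. Choosing \<open>x\<close> in a term of the lower central series whose successor contains no
  involution rules this out, which makes \<open>x\<close> central.\<close>

lemma (in group) nilpotent_even_obtains_central_involution:
  assumes fin: "finite (carrier G)" and nil: "nilpotent G" and even: "even (order G)"
  obtains t where "central_involution G t"
proof -
  define I where "I = (\<lambda>n. \<exists>x \<in> lower_central G n. x \<noteq> \<one> \<and> x \<otimes> x = \<one>)"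
  obtain N where N: "lower_central G N = {\<one>}"
    using nil by (auto simp: nilpotent_def)
  obtain m where "order G = 2 ^ 1 * m"
    using even by auto
  then obtain T where T: "subgroup T G" "card T = 2"
    using sylow_thm[OF two_is_prime_nat group_axioms _ fin, of 1 m] by auto
  then obtain a b where "T = {a, b}" "a \<noteq> b"
    by (auto simp: card_2_iff)
  moreover have "\<one> \<in> T"
    using T(1) by (rule subgroup.one_closed)
  ultimately have "T = {\<one>, if a = \<one> then b else a} \<and> (if a = \<one> then b else a) \<noteq> \<one>"
    by auto
  then obtain s where s: "s \<in> T" "s \<noteq> \<one>" "T = {\<one>, s}"
    by auto
  have "s \<in> carrier G"
    using s(1) T(1) subgroup.subset by blast
  moreover have "s \<otimes> s \<in> T"
    using subgroup.m_closed[OF T(1) s(1) s(1)] .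
  ultimately have "s \<otimes> s = \<one>"
    using s by (metis insertE l_cancel_one' singletonD)
  then have "I 0"
    using s \<open>s \<in> carrier G\<close> by (auto simp: I_def)
  moreover have "\<not> I N"
    using N by (simp add: I_def)
  ultimately obtain n where n: "I n" "\<not> I (Suc n)"
    using obtain_last_before_failure[of I N] by blast
  then obtain x where x: "x \<in> lower_central G n" "x \<noteq> \<one>" "x \<otimes> x = \<one>"
    by (auto simp: I_def)
  have xG: "x \<in> carrier G"
    using x(1) lower_central_subgroup subgroup.subset by blast
  have xinv: "inv x = x"
    using xG x inv_equality by blast
  have "x \<otimes> y = y \<otimes> x" if y: "y \<in> carrier G" for y
  proof -
    define c where "c = x \<otimes> y \<otimes> inv x \<otimes> inv y"
    have c: "c \<in> carrier G" "c \<in> lower_central G (Suc n)"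
      using xG y commutator_in_lower_central_Suc[OF x(1) y] by (auto simp: c_def)
    have "x \<otimes> c \<otimes> x = (x \<otimes> x) \<otimes> y \<otimes> x \<otimes> inv y \<otimes> x"
      using xG y by (simp add: c_def xinv m_assoc)
    also have "\<dots> = inv c"
      unfolding x(3) using xG y by (simp add: c_def xinv inv_mult_group m_assoc)
    finally have inverted: "x \<otimes> c \<otimes> x = inv c" .
    have "c [^] ((2::nat) ^ N) \<in> lower_central G N"
      using inverted_power_in_lower_central[OF xG x(3) c(1) inverted] by blast
    then have last: "c [^] ((2::nat) ^ N) = \<one>"
      using N by simp
    have "c = \<one>"
    proof (rule ccontr)
      assume "c \<noteq> \<one>"
      then have "c [^] ((2::nat) ^ 0) \<noteq> \<one>"
        using c by simp
      then obtain k where k: "c [^] ((2::nat) ^ k) \<noteq> \<one>" "c [^] ((2::nat) ^ Suc k) = \<one>"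
        using last obtain_last_before_failure[of "\<lambda>k. c [^] ((2::nat) ^ k) \<noteq> \<one>" N] by blast
      define z where "z = c [^] ((2::nat) ^ k)"
      have "z \<otimes> z = c [^] ((2::nat) ^ Suc k)"
        using c by (simp add: z_def nat_pow_mult mult_2)
      moreover have "z \<in> lower_central G (Suc n)"
        using subgroup_int_pow_closed[OF lower_central_subgroup c(2), of "int (2 ^ k)"]
        by (simp only: int_pow_int z_def)
      ultimately have "I (Suc n)"
        using k by (auto simp: I_def z_def simp del: lower_central.simps)
      then show False
        using n by blast
    qed
    then have "x \<otimes> y \<otimes> inv (y \<otimes> x) = \<one>"
      using xG y by (simp add: c_def inv_mult_group m_assoc)
    then show ?thesis
      using xG y by (metis inv_closed inv_equality inv_inv m_closed)
  qed
  then have "central_involution G x"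
    unfolding central_involution_def using xG x(2,3) by blast
  then show ?thesis
    by (rule that)
qed

section \<open>Cyclic subgroups of odd order and index two\<close>

lemma order_product_integer_mod_groups:
  "order (integer_mod_group m \<times>\<times> integer_mod_group n) = m * n" if "m > 0" "n > 0"
  using that by (simp add: order_def carrier_integer_mod_group)

lemma (in group) iso_product_imp_cyclic_index2:
  assumes iso: "G \<cong> integer_mod_group 2 \<times>\<times> integer_mod_group m" and "odd m"
  obtains w where "w \<in> carrier G" "card (generate G {w}) = m" "order G = 2 * m"
proof -
  let ?Z = "integer_mod_group 2 \<times>\<times> integer_mod_group m"
  have m: "m > 0"
    using \<open>odd m\<close> by (simp add: odd_pos)
  have Z: "group ?Z"
    by (simp add: DirProd_group)
  obtain f where f: "f \<in> iso ?Z G"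
    using iso_sym[OF iso] by (auto simp: is_iso_def)
  then interpret f: group_hom ?Z G f
    by (simp add: Z group_hom_axioms_def group_hom_def group_axioms iso_def)
  have inj: "inj_on f (carrier ?Z)"
    using f by (simp add: iso_def bij_betw_def)
  \<comment> \<open>Reducing the second component keeps \<open>u\<close> in the carrier also for \<open>m = 1\<close>.\<close>
  define u :: "int \<times> int" where "u = (0, 1 mod int m)"
  have u: "u \<in> carrier ?Z"
    using m by (simp add: u_def carrier_integer_mod_group)
  have pow: "u [^]\<^bsub>?Z\<^esub> n = (0, int n mod int m)" for n :: nat
  proof (induction n)
    case 0
    then show ?case by simp
  next
    case (Suc n)
    then show ?case
      by (simp add: u_def mod_simps add.commute)
  qed
  have "(f u [^] n = \<one>) \<longleftrightarrow> m dvd n" for n :: nat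
  proof -
    have "f u [^] n = f (u [^]\<^bsub>?Z\<^esub> n)"
      using u f.hom_nat_pow by simp
    also have "\<dots> = \<one> \<longleftrightarrow> u [^]\<^bsub>?Z\<^esub> n = \<one>\<^bsub>?Z\<^esub>"
      using inj u group.is_monoid[OF Z] by (metis f.hom_one f.inj_on_one_iff monoid.nat_pow_closed)
    also have "\<dots> \<longleftrightarrow> m dvd n"
      by (simp add: pow mod_eq_0_iff_dvd)
    finally show ?thesis .
  qed
  then have "ord (f u) = m"
    using u f.hom_closed ord_unique by blast
  then show ?thesis
    using that[of "f u"] u f.hom_closed generate_pow_card iso_same_card[OF iso]
      order_product_integer_mod_groups[of 2 m] m by (simp add: order_def)
qed

text \<open>The isomorphism sends \<open>(a, b)\<close> to \<open>t [^] a \<otimes> w [^] b\<close>. It is injective because a subgroup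
  of odd order cannot contain \<open>t\<close>, and surjective by counting.\<close>

lemma (in group) cyclic_index2_imp_iso_product:
  assumes t: "central_involution G t" and fin: "finite (carrier G)" and w: "w \<in> carrier G"
    and odd: "odd (card (generate G {w}))" and index: "order G = 2 * card (generate G {w})"
  shows "G \<cong> integer_mod_group 2 \<times>\<times> integer_mod_group (card (generate G {w}))"
proof -
  define m where "m = card (generate G {w})"
  let ?Z = "integer_mod_group 2 \<times>\<times> integer_mod_group m"
  define h :: "int \<times> int \<Rightarrow> 'a" where "h = (\<lambda>(a, b). t [^] a \<otimes> w [^] b)"
  have tG: "t \<in> carrier G" "t \<noteq> \<one>" "t \<otimes> t = \<one>" and comm: "\<And>x. x \<in> carrier G \<Longrightarrow> t \<otimes> x = x \<otimes> t"
    using t by (auto simp: central_involution_def)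
  have m: "m > 0"
    using odd by (simp add: m_def odd_pos)
  have Z: "group ?Z"
    by (simp add: DirProd_group)
  have ord_w: "ord w = m"
    using generate_pow_card[OF w] by (simp add: m_def)
  have t2: "t [^] (2::int) = \<one>"
    using tG int_pow_int[of G t 2] by (simp add: numeral_2_eq_2)
  have t_mod: "t [^] (a mod 2) = t [^] a" for a :: int
  proof -
    have "int (ord t) dvd 2"
      using tG t2 int_pow_eq_id by blast
    then have "int (ord t) dvd a - a mod 2"
      by (simp add: minus_mod_eq_div_mult)
    then show ?thesis
      using tG int_pow_eq by blast
  qed
  have w_mod: "w [^] (b mod int m) = w [^] b" for b :: int
    using w by (simp add: int_pow_eq ord_w minus_mod_eq_div_mult)
  have t_inv: "w [^] b \<otimes> t [^] a = t [^] a \<otimes> w [^] b" for a b :: int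
  proof -
    have "a mod 2 = 0 \<or> a mod 2 = 1"
      by auto
    then have "t [^] (a mod 2) = \<one> \<or> t [^] (a mod 2) = t"
      using tG by (metis int_pow_0 int_pow_1)
    then show ?thesis
      using t_mod[of a] comm[of "w [^] b"] w by auto
  qed
  have hom: "h \<in> hom ?Z G"
  proof (rule homI)
    fix x assume "x \<in> carrier ?Z"
    then show "h x \<in> carrier G"
      using tG w by (auto simp: h_def)
  next
    fix x y assume "x \<in> carrier ?Z" "y \<in> carrier ?Z"
    obtain a b c d where xy: "x = (a, b)" "y = (c, d)"
      by fastforce
    have "h (x \<otimes>\<^bsub>?Z\<^esub> y) = t [^] (a + c) \<otimes> w [^] (b + d)"
      by (simp add: xy h_def t_mod w_mod)
    also have "\<dots> = t [^] a \<otimes> (t [^] c \<otimes> w [^] b) \<otimes> w [^] d"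
      using tG w by (simp add: int_pow_mult m_assoc)
    also have "\<dots> = t [^] a \<otimes> (w [^] b \<otimes> t [^] c) \<otimes> w [^] d"
      by (simp only: t_inv)
    also have "\<dots> = h x \<otimes> h y"
      using tG w by (simp add: xy h_def m_assoc)
    finally show "h (x \<otimes>\<^bsub>?Z\<^esub> y) = h x \<otimes> h y" .
  qed
  have wsub: "subgroup (generate G {w}) G"
    using w by (intro generate_is_subgroup) simp
  have "x = \<one>\<^bsub>?Z\<^esub>" if x: "x \<in> carrier ?Z" "h x = \<one>" for x
  proof -
    obtain a b where ab: "x = (a, b)" "a \<in> {0..<2}" "b \<in> {0..<int m}"
      using x m by (auto simp: carrier_integer_mod_group)
    have a: "a = 0 \<or> a = 1"
      using ab by auto
    have "a \<noteq> 1"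
    proof
      assume "a = 1"
      then have "t \<otimes> w [^] b = \<one>"
        using x tG by (simp add: h_def ab)
      then have "t = inv (w [^] b)"
        using tG w by (metis int_pow_closed inv_equality)
      also have "\<dots> = w [^] (- b)"
        using w by (simp add: int_pow_neg)
      also have "\<dots> \<in> generate G {w}"
        using generate_pow[OF w] by blast
      finally have "even (card (generate G {w}))"
        using even_card_if_involution_mem[OF wsub] tG by blast
      then show False
        using odd by blast
    qed
    then have "w [^] b = \<one>"
      using a x w by (simp add: h_def ab)
    then have "int m dvd b"
      using w ord_w int_pow_eq_id by blast
    then have "b = 0"
      using ab zdvd_not_zless[of b "int m"] by force
    then show ?thesis
      using a \<open>a \<noteq> 1\<close> ab by simp
  qed
  then have inj: "inj_on h (carrier ?Z)"
    using inj_on_one_iff'[OF hom Z group_axioms] by blast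
  have "card (h ` carrier ?Z) = order G"
    using card_image[OF inj] order_product_integer_mod_groups[of 2 m] m index
    by (simp add: order_def m_def)
  moreover have "h ` carrier ?Z \<subseteq> carrier G"
    using hom by (auto simp: hom_def)
  ultimately have "h ` carrier ?Z = carrier G"
    using fin by (simp add: card_subset_eq order_def)
  then have "h \<in> iso ?Z G"
    using hom inj by (simp add: iso_def bij_betw_def)
  then have "?Z \<cong> G"
    by (auto simp: is_iso_def)
  then show ?thesis
    using group.iso_sym[OF Z] by (simp add: m_def)
qed

section \<open>Nim-numbers of positions of the avoidance game\<close>

lemma mex_eqI:
  assumes "n \<notin> A" "\<And>k. k < n \<Longrightarrow> k \<in> A"
  shows "mex A = n"
  unfolding mex_def using assms by (intro Least_equality) (auto simp: not_less[symmetric])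

lemma mex_notin_finite:
  assumes "finite A"
  shows "mex A \<notin> A"
  unfolding mex_def using assms by (metis LeastI ex_new_if_finite infinite_UNIV_nat)

definition dng_moves :: "('a, 'b) monoid_scheme \<Rightarrow> 'a set \<Rightarrow> 'a set set" where
  "dng_moves G P = {Q \<in> dng_positions G. \<exists>g \<in> carrier G - P. Q = insert g P}"

abbreviation dng_nim :: "('a, 'b) monoid_scheme \<Rightarrow> 'a set \<Rightarrow> nat" where
  "dng_nim G \<equiv> nim_number (dng_option_rel G)"

lemma dng_option_rel_iff:
  assumes "P \<in> dng_positions G"
  shows "(Q, P) \<in> dng_option_rel G \<longleftrightarrow> Q \<in> dng_moves G P"
  using assms by (auto simp: dng_option_rel_def dng_moves_def)

lemma dng_nim_eq:
  assumes "finite (carrier G)" "P \<in> dng_positions G"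
  shows "dng_nim G P = mex (dng_nim G ` dng_moves G P)"
  by (subst nim_number_eq[OF wf_dng_option_rel[OF assms(1)]])
    (simp add: dng_option_rel_iff[OF assms(2)] image_def conj_commute Bex_def)

lemma dng_induct [consumes 2, case_names options]:
  assumes "finite (carrier G)" "P \<in> dng_positions G"
    and "\<And>P. P \<in> dng_positions G \<Longrightarrow> (\<And>Q. Q \<in> dng_moves G P \<Longrightarrow> \<Phi> Q) \<Longrightarrow> \<Phi> P"
  shows "\<Phi> P"
  using wf_dng_option_rel[OF assms(1)] assms(2)
proof (induction P rule: wf_induct_rule)
  case (less P)
  show ?case
  proof (rule assms(3)[OF less.prems])
    fix Q assume Q: "Q \<in> dng_moves G P"
    then have "Q \<in> dng_positions G"
      by (simp add: dng_moves_def)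
    then show "\<Phi> Q"
      using less.IH Q dng_option_rel_iff[OF less.prems] by blast
  qed
qed

lemma finite_dng_moves:
  assumes "finite (carrier G)"
  shows "finite (dng_moves G P)"
  by (rule finite_subset[of _ "(\<lambda>g. insert g P) ` carrier G"])
    (use assms in \<open>auto simp: dng_moves_def\<close>)

lemma card_dng_option:
  assumes "finite (carrier G)" "P \<in> dng_positions G" "Q \<in> dng_moves G P"
  shows "card Q = Suc (card P)"
proof -
  have "finite P"
    using assms(1,2) by (auto simp: dng_positions_def intro: finite_subset)
  then show ?thesis
    using assms(3) by (auto simp: dng_moves_def)
qed

lemma (in group) insert_generated_in_dng_moves:
  assumes "P \<in> dng_positions G" "g \<in> generate G P - P"
  shows "insert g P \<in> dng_moves G P"
    and "generate G (insert g P) = generate G P"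
proof -
  have P: "P \<subseteq> carrier G"
    using assms by (simp add: dng_positions_def)
  have g: "g \<in> carrier G"
    using assms generate_incl[OF P] by blast
  have "generate G (insert g P) \<subseteq> generate G P"
    using assms generate_is_subgroup[OF P] by (intro generate_subgroup_incl) (auto intro: generate.incl)
  moreover have "generate G P \<subseteq> generate G (insert g P)"
    by (intro mono_generate) auto
  ultimately show eq: "generate G (insert g P) = generate G P"
    by blast
  show "insert g P \<in> dng_moves G P"
    using assms P g eq by (auto simp: dng_moves_def dng_positions_def)
qed

text \<open>Play stops only at a full subgroup, since otherwise a generated but unselected element is
  still available. Hence, if all proper subgroups above \<open>P\<close> have orders of one parity, the parity
  of the number of remaining moves is forced.\<close>

lemma (in group) dng_nim_if_parity_forced:
  assumes fin: "finite (carrier G)" and P: "P \<in> dng_positions G"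
    and parity: "\<And>K. \<lbrakk>subgroup K G; P \<subseteq> K; K \<noteq> carrier G\<rbrakk> \<Longrightarrow> even (card K) \<longleftrightarrow> e"
  shows "dng_nim G P = (if even (card P) \<longleftrightarrow> e then 0 else 1)"
  using fin P parity
proof (induction P rule: dng_induct)
  case (options P)
  have opt: "dng_nim G Q = (if even (card P) \<longleftrightarrow> e then 1 else 0)" if Q: "Q \<in> dng_moves G P" for Q
  proof -
    have "P \<subseteq> Q"
      using Q by (auto simp: dng_moves_def)
    then have "dng_nim G Q = (if even (card Q) \<longleftrightarrow> e then 0 else 1)"
      using options.IH[OF Q] options.prems by blast
    then show ?thesis
      using card_dng_option[OF fin options.hyps Q] by auto
  qed
  show ?case
  proof (cases "even (card P) \<longleftrightarrow> e")
    case True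
    then show ?thesis
      using opt by (auto simp: dng_nim_eq[OF fin options.hyps] intro!: mex_eqI)
  next
    case False
    have PG: "P \<subseteq> carrier G" "generate G P \<noteq> carrier G"
      using options.hyps by (auto simp: dng_positions_def)
    have sub: "P \<subseteq> generate G P"
      by (auto intro: generate.incl)
    have "even (card (generate G P)) \<longleftrightarrow> e"
      using options.prems generate_is_subgroup[OF PG(1)] sub PG(2) by blast
    then have "generate G P \<noteq> P"
      using False by auto
    then obtain g where "g \<in> generate G P - P"
      using sub by blast
    then have "insert g P \<in> dng_moves G P"
      using insert_generated_in_dng_moves options.hyps by blast
    then have "dng_nim G ` dng_moves G P = {0}"
      using opt False by (auto simp: image_iff)
    then show ?thesis
      using False by (simp add: dng_nim_eq[OF fin options.hyps] mex_eqI)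
  qed
qed

lemma (in group) dng_nim_if_even_generate:
  assumes "finite (carrier G)" "P \<in> dng_positions G" "even (card (generate G P))"
  shows "dng_nim G P = (if even (card P) then 0 else 1)"
proof -
  have PG: "P \<subseteq> carrier G"
    using assms by (simp add: dng_positions_def)
  have "even (card K)" if "subgroup K G" "P \<subseteq> K" for K
    using that assms(3) card_subgroup_dvd_card_subgroup[OF generate_is_subgroup[OF PG] that(1)]
      generate_subgroup_incl[OF that(2,1)] dvd_trans by blast
  then show ?thesis
    using dng_nim_if_parity_forced[OF assms(1,2), of True] by simp
qed

text \<open>The only proper subgroup above \<open>P\<close> is \<open>\<langle>P\<rangle>\<close> itself, so the final count is odd.\<close>

lemma (in group) dng_nim_if_generate_odd_index2:
  assumes "finite (carrier G)" "P \<in> dng_positions G" "odd (card (generate G P))"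
    and "order G = 2 * card (generate G P)"
  shows "dng_nim G P = (if even (card P) then 1 else 0)"
proof -
  have PG: "P \<subseteq> carrier G"
    using assms by (simp add: dng_positions_def)
  have "odd (card K)" if K: "subgroup K G" "P \<subseteq> K" "K \<noteq> carrier G" for K
  proof -
    have "card (generate G P) dvd card K"
      using card_subgroup_dvd_card_subgroup[OF generate_is_subgroup[OF PG] K(1)]
        generate_subgroup_incl[OF K(2,1)] by blast
    then obtain q where q: "card K = card (generate G P) * q"
      by (auto elim: dvdE)
    have "card K < order G"
      unfolding order_def using K subgroup.subset[OF K(1)] assms(1) by (intro psubset_card_mono) auto
    then have "q < 2"
      using q assms(4) by simp
    moreover have "card K > 0"
      using subgroup.one_closed[OF K(1)] subgroup.subset[OF K(1)] assms(1)
      by (metis card_gt_0_iff empty_iff finite_subset)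
    ultimately have "q = 1"
      using q by (cases q) auto
    then show ?thesis
      using q assms(3) by simp
  qed
  then show ?thesis
    using dng_nim_if_parity_forced[OF assms(1,2), of False] by auto
qed

section \<open>The value of the avoidance game\<close>

lemma (in group) empty_in_dng_positions:
  assumes "\<not> trivial_group G"
  shows "{} \<in> dng_positions G"
  using assms group_axioms by (auto simp: dng_positions_def generate_empty trivial_group_def)

lemma (in group) DNG_eq_1_if_proper_subgroups_odd:
  assumes "finite (carrier G)" "\<not> trivial_group G"
    and "\<And>K. \<lbrakk>subgroup K G; K \<noteq> carrier G\<rbrakk> \<Longrightarrow> odd (card K)"
  shows "DNG G = 1"
  using dng_nim_if_parity_forced[OF assms(1) empty_in_dng_positions[OF assms(2)], of False] assms(3)
  by (simp add: DNG_def)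

text \<open>No first move \<open>g\<close> reaches value 0. If \<open>g\<close> has even order, one chosen element and an even final
  count give value 1. If \<open>g\<close> has odd order, the reply \<open>t\<close> is legal by the hypothesis on cyclic
  subgroups and leaves two chosen elements with an even final count, a position of value 0.\<close>

lemma (in group) DNG_eq_0_if_no_odd_cyclic_index2:
  assumes fin: "finite (carrier G)" and nontriv: "\<not> trivial_group G" and t: "central_involution G t"
    and no: "\<And>w. \<lbrakk>w \<in> carrier G; odd (card (generate G {w}))\<rbrakk> \<Longrightarrow> order G \<noteq> 2 * card (generate G {w})"
  shows "DNG G = 0"
proof -
  have tG: "t \<in> carrier G" "t \<noteq> \<one>" "t \<otimes> t = \<one>"
    using t by (auto simp: central_involution_def)
  have "dng_nim G Q \<noteq> 0" if Q: "Q \<in> dng_moves G {}" for Q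
  proof -
    obtain g where g: "g \<in> carrier G" "Q = {g}"
      using Q by (auto simp: dng_moves_def)
    have pos: "Q \<in> dng_positions G"
      using Q by (simp add: dng_moves_def)
    show ?thesis
    proof (cases "even (card (generate G Q))")
      case True
      then show ?thesis
        using dng_nim_if_even_generate[OF fin pos] g by simp
    next
      case False
      have sub: "subgroup (generate G Q) G"
        using g by (intro generate_is_subgroup) auto
      have "t \<noteq> g"
        using even_card_if_involution_mem[OF sub _ tG(2,3)] False g by (auto intro: generate.incl)
      have "generate G (insert t Q) \<noteq> carrier G"
        using index2_if_generate_insert_central_involution[OF t fin, of Q] False no g by auto
      then have R: "insert t Q \<in> dng_positions G" "insert t Q \<in> dng_moves G Q"
        using tG g \<open>t \<noteq> g\<close> by (auto simp: dng_positions_def dng_moves_def)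
      have "subgroup (generate G (insert t Q)) G"
        using tG g by (intro generate_is_subgroup) auto
      then have "even (card (generate G (insert t Q)))"
        using even_card_if_involution_mem[OF _ _ tG(2,3)] by (auto intro: generate.incl)
      then have "dng_nim G (insert t Q) = 0"
        using dng_nim_if_even_generate[OF fin R(1)] g \<open>t \<noteq> g\<close> by simp
      then have "0 \<in> dng_nim G ` dng_moves G Q"
        using R(2) by force
      then show ?thesis
        using dng_nim_eq[OF fin pos] mex_notin_finite finite_dng_moves[OF fin] by (metis finite_imageI)
    qed
  qed
  then have "0 \<notin> dng_nim G ` dng_moves G {}"
    by force
  then show ?thesis
    by (simp add: DNG_def dng_nim_eq[OF fin empty_in_dng_positions[OF nontriv]] mex_eqI)
qed

text \<open>Here \<open>\<langle>P\<rangle>\<close> is a proper subgroup of \<open>M = \<langle>w\<rangle>\<close>, and the final parity is still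
  undecided. The moves \<open>t\<close> and \<open>w\<close> decide it in opposite ways, so the values 0 and 1 are both among
  the options. When \<open>card P\<close> is even,
  such an option exists, because \<open>P\<close> cannot exhaust a subgroup of odd order; its value 2
  pushes the value of \<open>P\<close> to 3. When \<open>card P\<close> is odd, undecided options can only have value 3, and
  the least missing value is 2.\<close>

lemma (in group) dng_nim_if_generate_odd_nonmaximal:
  assumes fin: "finite (carrier G)" and t: "central_involution G t" and w: "w \<in> carrier G"
    and odd_w: "odd (card (generate G {w}))" and index: "order G = 2 * card (generate G {w})"
    and P: "P \<in> dng_positions G"
    and odd_P: "odd (card (generate G P))" and ne: "order G \<noteq> 2 * card (generate G P)"
  shows "dng_nim G P = (if even (card P) then 3 else 2)"
  using fin P odd_P ne
proof (induction P rule: dng_induct)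
  case (options P)
  define M where "M = generate G {w}"
  have tG: "t \<in> carrier G" "t \<noteq> \<one>" "t \<otimes> t = \<one>"
    using t by (auto simp: central_involution_def)
  have M: "subgroup M G"
    unfolding M_def using w by (intro generate_is_subgroup) simp
  have MG: "M \<noteq> carrier G"
    using index fin order_gt_0_iff_finite by (auto simp: M_def order_def)
  have PG: "P \<subseteq> carrier G"
    using options.hyps by (simp add: dng_positions_def)
  have H: "subgroup (generate G P) G"
    using PG by (rule generate_is_subgroup)
  have sub: "P \<subseteq> generate G P"
    by (auto intro: generate.incl)
  have HM: "generate G P \<subseteq> M"
    using odd_subgroup_le_index2_subgroup[OF M _ fin H] index options.prems by (simp add: M_def)
  have tP: "t \<notin> P"
    using even_card_if_involution_mem[OF H _ tG(2,3)] options.prems sub by blast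
  have "generate G (insert t P) \<noteq> carrier G"
    using index2_if_generate_insert_central_involution[OF t fin PG] options.prems by blast
  then have optt: "insert t P \<in> dng_moves G P" "insert t P \<in> dng_positions G"
    using tG tP PG by (auto simp: dng_positions_def dng_moves_def)
  have "subgroup (generate G (insert t P)) G"
    using tG PG by (intro generate_is_subgroup) auto
  then have "even (card (generate G (insert t P)))"
    using even_card_if_involution_mem[OF _ _ tG(2,3)] by (auto intro: generate.incl)
  then have nimt: "dng_nim G (insert t P) = (if even (card P) then 1 else 0)"
    using dng_nim_if_even_generate[OF fin optt(2)] card_dng_option[OF fin options.hyps optt(1)] by simp
  have genw: "generate G (insert w P) = M"
  proof
    show "generate G (insert w P) \<subseteq> M"
      using M HM sub by (intro generate_subgroup_incl) (auto simp: M_def intro: generate.incl)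
    show "M \<subseteq> generate G (insert w P)"
      unfolding M_def by (intro mono_generate) auto
  qed
  have "w \<notin> P"
    using genw options.prems index by (auto simp: insert_absorb M_def)
  then have optw: "insert w P \<in> dng_moves G P" "insert w P \<in> dng_positions G"
    using genw MG w PG by (auto simp: dng_positions_def dng_moves_def)
  have nimw: "dng_nim G (insert w P) = (if even (card P) then 0 else 1)"
    using dng_nim_if_generate_odd_index2[OF fin optw(2)] card_dng_option[OF fin options.hyps optw(1)]
      genw odd_w index by (simp add: M_def)
  have others: "dng_nim G Q \<noteq> (if even (card P) then 3 else 2)" if Q: "Q \<in> dng_moves G P" for Q
  proof -
    have pos: "Q \<in> dng_positions G"
      using Q by (simp add: dng_moves_def)
    have card: "card Q = Suc (card P)"
      using card_dng_option[OF fin options.hyps Q] .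
    consider "even (card (generate G Q))" | "odd (card (generate G Q))" "order G = 2 * card (generate G Q)"
      | "odd (card (generate G Q))" "order G \<noteq> 2 * card (generate G Q)"
      by blast
    then show ?thesis
    proof cases
      case 1
      then show ?thesis
        using dng_nim_if_even_generate[OF fin pos] card by simp
    next
      case 2
      then show ?thesis
        using dng_nim_if_generate_odd_index2[OF fin pos] card by simp
    next
      case 3
      then show ?thesis
        using options.IH[OF Q] card by simp
    qed
  qed
  show ?case
    unfolding dng_nim_eq[OF fin options.hyps]
  proof (rule mex_eqI)
    show "(if even (card P) then 3 else 2) \<notin> dng_nim G ` dng_moves G P"
      using others by fastforce
  next
    fix k :: nat assume k: "k < (if even (card P) then 3 else 2)"
    have 01: "0 \<in> dng_nim G ` dng_moves G P" "1 \<in> dng_nim G ` dng_moves G P"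
      using nimt nimw optt(1) optw(1) by (cases "even (card P)"; force)+
    have 2: "2 \<in> dng_nim G ` dng_moves G P" if even: "even (card P)"
    proof -
      have "generate G P \<noteq> P"
        using even options.prems by auto
      then obtain g where g: "g \<in> generate G P - P"
        using sub by blast
      note Q = insert_generated_in_dng_moves[OF options.hyps g]
      have "dng_nim G (insert g P) = 2"
        using options.IH[OF Q(1)] Q(2) options.prems card_dng_option[OF fin options.hyps Q(1)] even
        by simp
      then show ?thesis
        using Q(1) by force
    qed
    have "k = 0 \<or> k = 1 \<or> (k = 2 \<and> even (card P))"
      using k by (auto split: if_splits)
    then show "k \<in> dng_nim G ` dng_moves G P"
      using 01 2 by auto
  qed
qed

lemma (in group) DNG_eq_3_if_odd_cyclic_index2:
  assumes "finite (carrier G)" "central_involution G t" "w \<in> carrier G"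
    and "odd (card (generate G {w}))" "order G = 2 * card (generate G {w})" "order G \<noteq> 2"
  shows "DNG G = 3"
proof -
  have "t \<in> carrier G" "t \<noteq> \<one>"
    using assms(2) by (auto simp: central_involution_def)
  then have "\<not> trivial_group G"
    by (auto simp: trivial_group_def)
  then show ?thesis
    using dng_nim_if_generate_odd_nonmaximal[OF assms(1-5) empty_in_dng_positions] assms(6)
    by (simp add: DNG_def generate_empty)
qed

theorem proposition7p1:
  fixes G :: "('a, 'b) monoid_scheme"
  assumes "group G" and "finite (carrier G)" and "\<not> trivial_group G" and "nilpotent G"
  shows "(order G = 2 \<or> odd (order G) \<longrightarrow> DNG G = 1)
    \<and> ((\<exists>k::nat. k \<ge> 1 \<and> G \<cong> integer_mod_group 2 \<times>\<times> integer_mod_group (2 * k + 1)) \<longrightarrow> DNG G = 3)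
    \<and> (\<not> (order G = 2 \<or> odd (order G))
        \<and> \<not> (\<exists>k::nat. k \<ge> 1 \<and> G \<cong> integer_mod_group 2 \<times>\<times> integer_mod_group (2 * k + 1))
        \<longrightarrow> DNG G = 0)"
proof (intro conjI impI)
  interpret group G by fact
  assume small: "order G = 2 \<or> odd (order G)"
  show "DNG G = 1"
  proof (rule DNG_eq_1_if_proper_subgroups_odd[OF assms(2,3)])
    fix K assume K: "subgroup K G" "K \<noteq> carrier G"
    then have dvd: "card K dvd order G"
      using card_subgroup_dvd_order by blast
    have "card K < order G"
      unfolding order_def using K subgroup.subset[OF K(1)] assms(2) by (intro psubset_card_mono) auto
    show "odd (card K)"
      using small
    proof
      assume "order G = 2"
      then show ?thesis
        using dvd \<open>card K < order G\<close> by (cases "card K") auto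
    next
      assume "odd (order G)"
      then show ?thesis
        using dvd dvd_trans by blast
    qed
  qed
next
  interpret group G by fact
  assume "\<exists>k::nat. k \<ge> 1 \<and> G \<cong> integer_mod_group 2 \<times>\<times> integer_mod_group (2 * k + 1)"
  then obtain k where k: "k \<ge> 1" "G \<cong> integer_mod_group 2 \<times>\<times> integer_mod_group (2 * k + 1)"
    by blast
  then obtain w where w: "w \<in> carrier G" "card (generate G {w}) = 2 * k + 1" "order G = 2 * (2 * k + 1)"
    using iso_product_imp_cyclic_index2[OF k(2)] by auto
  then obtain t where "central_involution G t"
    using nilpotent_even_obtains_central_involution[OF assms(2,4)] by auto
  then show "DNG G = 3"
    using DNG_eq_3_if_odd_cyclic_index2[OF assms(2) _ w(1)] w k(1) by simp
next
  interpret group G by fact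
  assume *: "\<not> (order G = 2 \<or> odd (order G))
    \<and> \<not> (\<exists>k::nat. k \<ge> 1 \<and> G \<cong> integer_mod_group 2 \<times>\<times> integer_mod_group (2 * k + 1))"
  then obtain t where t: "central_involution G t"
    using nilpotent_even_obtains_central_involution[OF assms(2,4)] by blast
  show "DNG G = 0"
  proof (rule DNG_eq_0_if_no_odd_cyclic_index2[OF assms(2,3) t] notI)+
    fix w assume w: "w \<in> carrier G" "odd (card (generate G {w}))" "order G = 2 * card (generate G {w})"
    obtain k where k: "card (generate G {w}) = 2 * k + 1"
      using w(2) by (auto elim: oddE)
    have "k \<ge> 1"
      using * w(3) k by (cases k) auto
    moreover have "G \<cong> integer_mod_group 2 \<times>\<times> integer_mod_group (2 * k + 1)"
      using cyclic_index2_imp_iso_product[OF t assms(2) w] k by simp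
    ultimately show False
      using * by blast
  qed
qed

end
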